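(* Let $G=(V,E)$ be a finite graph with symmetric positive edge weights $w_{xy}=w_{yx}>0$ and a finite measure $\mu:V\to(0,\infty)$, let $\Delta$ be the associated $\mu$-Laplacian, and let $h:V\to\mathbb{R}$ be a function. For a negative constant $c$ consider the equation $$\Delta u=c-he^{u}\quad\text{in } V \qquad (\ast_c)$$ for $u:V\to\mathbb{R}$. (i) If $(\ast_c)$ has a solution for a given $c<0$, then $\overline{h}<0$. (ii) If $\overline{h}<0$, then there exists a constant $c_-(h)$ with $-\infty\le c_-(h)<0$, depending on $h$, such that $(\ast_c)$ has a solution for any $c$ with $c_-(h)<c<0$, but has no solution for any $c<c_-(h)$.
   Context: For $u:V\to\mathbb{R}$, the $\mu$-Laplacian is $\Delta u(x)=\frac{1}{\mu(x)}\sum_{y\sim x}w_{xy}(u(y)-u(x))$, where $y\sim x$ means $xy\in E$. For $g:V\to\mathbb{R}$, $\overline{g}=\frac{1}{\mathrm{Vol}(V)}\sum_{x\in V}\mu(x)g(x)$ with $\mathrm{Vol}(V)=\sum_{x\in V}\mu(x)$.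
   Formalization: Part (ii) is proved for connected graphs G; without connectedness it is false (two isolated vertices with h = 1 and h = −2, μ = 1: mean negative, but no solution for any c < 0). Part (i) is for all finite graphs. *)

theory Defs
  imports "HOL-Library.Extended_Real" "Graph_Theory.Digraph_Component"
begin

(* An undirected simple graph is a symmetric loop-free set of ordered pairs (pair_graph):
   the edge xy is present as both arcs (x, y) and (y, x).  Functions on the vertex set are
   total functions on 'a of which only the values on pverts G matter.
   The graph must be nonempty because the mean value divides by the volume;
   connectedness is not part of the locale. *)
locale weighted_graph = pair_graph G
  for G :: "'a pair_pre_digraph" +
  fixes w :: "'a \<Rightarrow> 'a \<Rightarrow> real" and \<mu> :: "'a \<Rightarrow> real"
  assumes verts_nonempty: "pverts G \<noteq> {}"
    and weight_sym: "(x, y) \<in> parcs G \<Longrightarrow> w x y = w y x"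
    and weight_pos: "(x, y) \<in> parcs G \<Longrightarrow> w x y > 0"
    and measure_pos: "x \<in> pverts G \<Longrightarrow> \<mu> x > 0"

definition laplacian ::
    "'a pair_pre_digraph \<Rightarrow> ('a \<Rightarrow> 'a \<Rightarrow> real) \<Rightarrow> ('a \<Rightarrow> real) \<Rightarrow> ('a \<Rightarrow> real) \<Rightarrow> 'a \<Rightarrow> real" where
  "laplacian G w \<mu> u x = (1 / \<mu> x) * (\<Sum>y | (x, y) \<in> parcs G. w x y * (u y - u x))"

definition vol :: "'a pair_pre_digraph \<Rightarrow> ('a \<Rightarrow> real) \<Rightarrow> real" where
  "vol G \<mu> = (\<Sum>x \<in> pverts G. \<mu> x)"

definition mean :: "'a pair_pre_digraph \<Rightarrow> ('a \<Rightarrow> real) \<Rightarrow> ('a \<Rightarrow> real) \<Rightarrow> real" where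
  "mean G \<mu> g = (1 / vol G \<mu>) * (\<Sum>x \<in> pverts G. \<mu> x * g x)"

definition kazdan_warner_solution ::
    "'a pair_pre_digraph \<Rightarrow> ('a \<Rightarrow> 'a \<Rightarrow> real) \<Rightarrow> ('a \<Rightarrow> real) \<Rightarrow> ('a \<Rightarrow> real) \<Rightarrow> real
      \<Rightarrow> ('a \<Rightarrow> real) \<Rightarrow> bool" where
  "kazdan_warner_solution G w \<mu> h c u \<longleftrightarrow>
     (\<forall>x \<in> pverts G. laplacian G w \<mu> u x = c - h x * exp (u x))"

end

theory Submission
  imports Defs "HOL-Analysis.Function_Topology"
begin

text \<open>For (i), multiply the equation by \<open>exp (- u)\<close> and sum: by Green's identity and the
  monotonicity of \<open>exp\<close> the Laplacian term has the right sign.  For (ii), a solution for \<open>c\<^sub>0\<close> is an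
  upper solution for every \<open>c\<close> in \<open>[c\<^sub>0, 0)\<close>, and very negative constants are lower solutions, so the
  admissible \<open>c\<close> form an interval ending at 0.  It is nonempty because a small multiple of a solution
  of the Poisson equation \<open>\<Delta> v = mean h - h\<close>, shifted by a constant, is an upper solution for some
  \<open>c < 0\<close>.  The Poisson equation itself is solved between sub- and supersolutions away from one
  vertex; the total mass of both sides being 0, it then also holds at that vertex.\<close>

context weighted_graph
begin

section \<open>Monotonicity of the Laplacian and Green's identity\<close>

abbreviation Lap :: "('a \<Rightarrow> real) \<Rightarrow> 'a \<Rightarrow> real" ("\<Delta>") where
  "\<Delta> \<equiv> laplacian G w \<mu>"

lemma arcs_sym: "(x, y) \<in> parcs G \<Longrightarrow> (y, x) \<in> parcs G"
  using pair_sym_arcs by (auto simp: symmetric_def sym_def)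

lemma finite_neighbours: "finite {y. (x, y) \<in> parcs G}"
  by (rule finite_subset[OF _ pair_finite_verts]) (auto dest: in_arcsD2)

lemma laplacian_cmult: "\<Delta> (\<lambda>x. a * u x) x = a * \<Delta> u x"
  unfolding laplacian_def by (simp add: sum_distrib_left algebra_simps)

lemma laplacian_add_const: "\<Delta> (\<lambda>x. u x + b) x = \<Delta> u x"
  unfolding laplacian_def by simp

lemma laplacian_const: "\<Delta> (\<lambda>x. b) x = 0"
  unfolding laplacian_def by simp

text \<open>Discrete form of the comparison at a touching point: with the value at \<open>x\<close>
  fixed, only neighbours matter, and they enter with positive weights.\<close>

lemma laplacian_mono:
  assumes "x \<in> pverts G" "u x = v x" "\<And>y. y \<in> pverts G \<Longrightarrow> u y \<le> v y"
  shows "\<Delta> u x \<le> \<Delta> v x"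
proof -
  have "(\<Sum>y | (x, y) \<in> parcs G. w x y * (u y - u x)) \<le> (\<Sum>y | (x, y) \<in> parcs G. w x y * (v y - v x))"
    using assms(2,3) by (intro sum_mono mult_left_mono) (auto dest: in_arcsD2 intro: less_imp_le weight_pos)
  then show ?thesis
    unfolding laplacian_def using measure_pos[OF assms(1)] by (intro mult_left_mono) auto
qed

lemma laplacian_cong:
  assumes "x \<in> pverts G" "\<And>y. y \<in> pverts G \<Longrightarrow> u y = v y"
  shows "\<Delta> u x = \<Delta> v x"
  by (rule antisym; rule laplacian_mono) (simp_all add: assms)

lemma continuous_on_laplacian:
  assumes "\<And>y. continuous_on S (\<lambda>s. f s y)"
  shows "continuous_on S (\<lambda>s. \<Delta> (f s) x)"
  unfolding laplacian_def by (intro continuous_intros assms)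

lemma green_identity:
  "2 * (\<Sum>x\<in>pverts G. \<mu> x * (g x * \<Delta> u x))
     = - (\<Sum>(x, y)\<in>parcs G. w x y * (u y - u x) * (g y - g x))"
proof -
  have A: "(\<Sum>x\<in>pverts G. \<mu> x * (g x * \<Delta> u x)) = (\<Sum>(x, y)\<in>parcs G. w x y * (u y - u x) * g x)"
  proof -
    have "(\<Sum>x\<in>pverts G. \<mu> x * (g x * \<Delta> u x))
        = (\<Sum>x\<in>pverts G. \<Sum>y | (x, y) \<in> parcs G. w x y * (u y - u x) * g x)"
    proof (rule sum.cong[OF refl])
      fix x assume "x \<in> pverts G"
      then have "\<mu> x \<noteq> 0" using measure_pos by fastforce
      then show "\<mu> x * (g x * \<Delta> u x) = (\<Sum>y | (x, y) \<in> parcs G. w x y * (u y - u x) * g x)"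
        unfolding laplacian_def by (simp add: sum_distrib_left mult_ac)
    qed
    also have "\<dots> = (\<Sum>(x, y)\<in>Sigma (pverts G) (\<lambda>x. {y. (x, y) \<in> parcs G}). w x y * (u y - u x) * g x)"
      using pair_finite_verts finite_neighbours by (intro sum.Sigma) auto
    also have "Sigma (pverts G) (\<lambda>x. {y. (x, y) \<in> parcs G}) = parcs G"
      by (auto dest: in_arcsD1)
    finally show ?thesis .
  qed
  \<comment> \<open>Reversing arcs is a bijection of \<open>parcs G\<close>; averaging with the
    reversed sum produces the difference of \<open>g\<close> and the factor 2.\<close>
  have B: "(\<Sum>(x, y)\<in>parcs G. w x y * (u y - u x) * g x) = (\<Sum>(x, y)\<in>parcs G. w x y * (u x - u y) * g y)"
    by (rule sum.reindex_bij_witness[where i="\<lambda>(x, y). (y, x)" and j="\<lambda>(x, y). (y, x)"])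
      (auto simp: arcs_sym weight_sym)
  have "2 * (\<Sum>x\<in>pverts G. \<mu> x * (g x * \<Delta> u x))
      = (\<Sum>(x, y)\<in>parcs G. w x y * (u y - u x) * g x) + (\<Sum>(x, y)\<in>parcs G. w x y * (u x - u y) * g y)"
    using A B by simp
  also have "\<dots> = - (\<Sum>(x, y)\<in>parcs G. w x y * (u y - u x) * (g y - g x))"
    unfolding sum.distrib[symmetric] sum_negf[symmetric]
    by (rule sum.cong) (auto simp: algebra_simps)
  finally show ?thesis .
qed

lemma sum_laplacian: "(\<Sum>x\<in>pverts G. \<mu> x * \<Delta> u x) = 0"
  using green_identity[of "\<lambda>_. 1" u] by simp

lemma vol_pos: "vol G \<mu> > 0"
  unfolding vol_def using measure_pos verts_nonempty pair_finite_verts by (intro sum_pos) auto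

section \<open>Necessity of a negative mean\<close>

lemma solution_imp_mean_neg:
  assumes "c < 0" "kazdan_warner_solution G w \<mu> h c u"
  shows "mean G \<mu> h < 0"
proof -
  have "(\<Sum>x\<in>pverts G. \<mu> x * h x)
      = (\<Sum>x\<in>pverts G. c * (\<mu> x * exp (- u x)) - \<mu> x * (exp (- u x) * \<Delta> u x))"
  proof (rule sum.cong[OF refl])
    fix x assume "x \<in> pverts G"
    then have "\<Delta> u x = c - h x * exp (u x)"
      using assms(2) by (simp add: kazdan_warner_solution_def)
    then show "\<mu> x * h x = c * (\<mu> x * exp (- u x)) - \<mu> x * (exp (- u x) * \<Delta> u x)"
      by (simp only:) (simp add: exp_minus field_simps)
  qed
  also have "\<dots> = c * (\<Sum>x\<in>pverts G. \<mu> x * exp (- u x)) - (\<Sum>x\<in>pverts G. \<mu> x * (exp (- u x) * \<Delta> u x))"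
    by (simp add: sum_subtractf sum_distrib_left)
  also have "\<dots> < 0"
  proof -
    have "(\<Sum>x\<in>pverts G. \<mu> x * exp (- u x)) > 0"
      using measure_pos verts_nonempty pair_finite_verts by (intro sum_pos) auto
    then have 1: "c * (\<Sum>x\<in>pverts G. \<mu> x * exp (- u x)) < 0"
      using assms(1) by (simp add: mult_neg_pos)
    \<comment> \<open>The differences of \<open>u\<close> and \<open>exp (- u)\<close> have opposite
      signs. By Green's identity the subtracted Laplacian sum is therefore nonnegative.\<close>
    have "(\<Sum>(x, y)\<in>parcs G. w x y * (u y - u x) * (exp (- u y) - exp (- u x))) \<le> 0"
    proof (rule sum_nonpos, clarify)
      fix x y assume "(x, y) \<in> parcs G"
      moreover have "(u y - u x) * (exp (- u y) - exp (- u x)) \<le> 0"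
        by (cases "u x \<le> u y") (simp_all add: mult_nonneg_nonpos mult_nonpos_nonneg)
      ultimately show "w x y * (u y - u x) * (exp (- u y) - exp (- u x)) \<le> 0"
        using weight_pos by (metis less_imp_le mult.assoc mult_nonneg_nonpos)
    qed
    then show ?thesis using 1 green_identity[of "\<lambda>x. exp (- u x)" u] by simp
  qed
  finally show ?thesis
    unfolding mean_def using vol_pos by (simp add: divide_neg_pos)
qed

section \<open>Solutions between sub- and supersolutions\<close>

text \<open>Both sides vary continuously with the value at \<open>x\<close>, so a strict inequality
  survives a small increase; \<open>b\<close> caps the increase.\<close>

lemma raise_subsolution:
  assumes "continuous_on UNIV N" "N (v x) < \<Delta> v x" "v x < b"
  obtains t where "v x < t" "t \<le> b" "N t < \<Delta> (v(x := t)) x"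
proof -
  let ?k = "\<lambda>t. \<Delta> (v(x := t)) x - N t"
  have "continuous_on UNIV (\<lambda>t. \<Delta> (v(x := t)) x)"
  proof (rule continuous_on_laplacian)
    show "continuous_on UNIV (\<lambda>t. (v(x := t)) y)" for y
      by (cases "y = x") (simp_all add: continuous_on_id)
  qed
  then have "isCont ?k (v x)"
    using assms(1) by (intro continuous_on_interior[of UNIV] continuous_intros) auto
  then have "eventually (\<lambda>t. ?k t > 0) (at (v x))"
    using assms(2) by (intro order_tendstoD[where y="?k (v x)"]) (auto simp: isCont_def)
  then have "eventually (\<lambda>t. ?k t > 0) (at_right (v x))"
    by (simp add: eventually_at_split)
  then have "eventually (\<lambda>t. ?k t > 0 \<and> t \<in> {v x<..<b}) (at_right (v x))"
    by (rule eventually_conj) (rule eventually_at_right_real[OF assms(3)])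
  then obtain t where "?k t > 0" "t \<in> {v x<..<b}"
    using eventually_happens'[OF trivial_limit_at_right_real] by blast
  then show thesis by (intro that[of t]) auto
qed

lemma laplacian_raise:
  assumes "z \<in> pverts G" "z \<noteq> x" "v x \<le> t"
  shows "\<Delta> v z \<le> \<Delta> (v(x := t)) z"
  using assms by (intro laplacian_mono) auto

text \<open>A subsolution of maximal sum between \<open>\<psi>\<close> and \<open>\<phi>\<close> is a solution: a vertex where
  the inequality is strict lies below \<open>\<phi>\<close>, so its value can be raised, which only helps
  the other vertices.\<close>

lemma sub_super_solution:
  assumes "U \<subseteq> pverts G"
    and N: "\<And>x. x \<in> U \<Longrightarrow> continuous_on UNIV (N x)"
    and le: "\<And>x. x \<in> pverts G \<Longrightarrow> \<psi> x \<le> \<phi> x"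
    and sub: "\<And>x. x \<in> U \<Longrightarrow> N x (\<psi> x) \<le> \<Delta> \<psi> x"
    and super: "\<And>x. x \<in> U \<Longrightarrow> \<Delta> \<phi> x \<le> N x (\<phi> x)"
  obtains v where "\<And>x. x \<in> U \<Longrightarrow> \<Delta> v x = N x (v x)"
proof -
  \<comment> \<open>Functions live on all of \<open>'a\<close>; pinning them to 0 off the graph
    makes the full product compact by Tychonoff.\<close>
  define B where "B x = (if x \<in> pverts G then {\<psi> x..\<phi> x} else {0})" for x
  define K where "K = PiE UNIV B \<inter> (\<Inter>x\<in>U. {v. N x (v x) \<le> \<Delta> v x})"
  have "compactin (product_topology (\<lambda>_. euclidean) UNIV) (PiE UNIV B)"
    unfolding compactin_PiE by (auto simp: B_def)
  then have "compact (PiE UNIV B)"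
    by (simp add: euclidean_product_topology)
  moreover have "closed {v. N x (v x) \<le> \<Delta> v x}" if "x \<in> U" for x
  proof (rule closed_Collect_le)
    show "continuous_on UNIV (\<lambda>v::'a \<Rightarrow> real. N x (v x))"
      using continuous_on_compose2[OF N[OF that] continuous_on_product_coordinates] by simp
    show "continuous_on UNIV (\<lambda>v. \<Delta> v x)"
      by (rule continuous_on_laplacian) simp
  qed
  ultimately have "compact K"
    unfolding K_def by (intro compact_Int_closed closed_INT) auto
  moreover have "K \<noteq> {}"
  proof -
    \<comment> \<open>\<open>\<psi>\<close> itself may be nonzero off the graph, so it is truncated
      to lie in \<open>K\<close>.\<close>
    let ?p = "\<lambda>x. if x \<in> pverts G then \<psi> x else 0"
    have "\<Delta> ?p x = \<Delta> \<psi> x" if "x \<in> U" for x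
      using that assms(1) by (intro laplacian_cong) auto
    then have "?p \<in> K"
      using assms(1) le sub by (auto simp: K_def B_def subset_iff)
    then show ?thesis by blast
  qed
  moreover have "continuous_on K (\<lambda>v. \<Sum>x\<in>pverts G. v x)"
    by (intro continuous_intros continuous_on_subset[OF continuous_on_product_coordinates]) auto
  ultimately obtain v where v: "v \<in> K" and max: "\<And>v'. v' \<in> K \<Longrightarrow> (\<Sum>x\<in>pverts G. v' x) \<le> (\<Sum>x\<in>pverts G. v x)"
    using continuous_attains_sup[of K "\<lambda>v. \<Sum>x\<in>pverts G. v x"] by blast
  have vB: "v x \<in> B x" for x using v by (auto simp: K_def)
  have vU: "N x (v x) \<le> \<Delta> v x" if "x \<in> U" for x using v that by (auto simp: K_def)
  show thesis
  proof (rule that, rule ccontr)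
    fix x assume x: "x \<in> U" and ne: "\<Delta> v x \<noteq> N x (v x)"
    then have xV: "x \<in> pverts G" using assms(1) by auto
    have strict: "N x (v x) < \<Delta> v x" using vU[OF x] ne by simp
    \<comment> \<open>If \<open>v\<close> touched \<open>\<phi>\<close> at \<open>x\<close>,
      comparison would give \<open>\<Delta> v x \<le> \<Delta> \<phi> x \<le> N x (v x)\<close>,
      against strictness.\<close>
    have "v x \<noteq> \<phi> x"
    proof
      assume eq: "v x = \<phi> x"
      have "\<Delta> v x \<le> \<Delta> \<phi> x"
      proof (rule laplacian_mono[of x v \<phi>, OF xV eq])
        fix y assume "y \<in> pverts G"
        then show "v y \<le> \<phi> y" using vB[of y] by (simp add: B_def)
      qed
      then show False using super[OF x] strict eq by simp
    qed
    then have "v x < \<phi> x" using vB[of x] xV by (simp add: B_def)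
    then obtain t where t: "v x < t" "t \<le> \<phi> x" "N x t < \<Delta> (v(x := t)) x"
      using raise_subsolution[of "N x" v x "\<phi> x"] N[OF x] strict by blast
    have "v(x := t) \<in> K"
    proof -
      have "(v(x := t)) y \<in> B y" for y
        using vB[of y] vB[of x] t(1,2) xV by (auto simp: B_def)
      moreover have "N y ((v(x := t)) y) \<le> \<Delta> (v(x := t)) y" if y: "y \<in> U" for y
      proof (cases "y = x")
        case False
        then show ?thesis using vU[OF y] laplacian_raise[of y x v t] t(1) y assms(1) by auto
      qed (use t(3) in simp)
      ultimately show ?thesis unfolding K_def by blast
    qed
    moreover have "(\<Sum>z\<in>pverts G. v z) < (\<Sum>z\<in>pverts G. (v(x := t)) z)"
      using t(1) xV pair_finite_verts by (intro sum_strict_mono_ex1) auto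
    ultimately show False using max by fastforce
  qed
qed

section \<open>Solvability below an upper solution\<close>

lemma kazdan_warner_solvable_from_upper:
  assumes "c < 0" and super: "\<And>x. x \<in> pverts G \<Longrightarrow> \<Delta> \<phi> x \<le> c - h x * exp (\<phi> x)"
  shows "\<exists>u. kazdan_warner_solution G w \<mu> h c u"
proof -
  define H where "H = 1 + (\<Sum>x\<in>pverts G. \<bar>h x\<bar>)"
  define M where "M = (\<Sum>x\<in>pverts G. \<bar>\<phi> x\<bar>)"
  \<comment> \<open>A constant \<open>b\<close> is a lower solution once
    \<open>H * exp b \<le> - c\<close>, and lies below \<open>\<phi>\<close> once
    \<open>b \<le> - M\<close>. The summand 1 in \<open>H\<close> keeps the quotient defined when
    \<open>h\<close> vanishes.\<close>
  define b where "b = min (ln (- c / H)) (- M)"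
  have Hpos: "H > 0" unfolding H_def by (simp add: sum_nonneg add_pos_nonneg)
  have hH: "\<bar>h x\<bar> \<le> H" if "x \<in> pverts G" for x
    using member_le_sum[of x "pverts G" "\<lambda>x. \<bar>h x\<bar>"] that pair_finite_verts by (simp add: H_def)
  have \<phi>M: "\<bar>\<phi> x\<bar> \<le> M" if "x \<in> pverts G" for x
    using member_le_sum[of x "pverts G" "\<lambda>x. \<bar>\<phi> x\<bar>"] that pair_finite_verts by (simp add: M_def)
  have "exp b \<le> exp (ln (- c / H))" unfolding b_def by simp
  then have eb: "H * exp b \<le> - c" using Hpos assms(1) by (simp add: field_simps)
  have sub: "c - h x * exp b \<le> 0" if "x \<in> pverts G" for x
  proof -
    have "- h x * exp b \<le> H * exp b" using hH[OF that] by (intro mult_right_mono) auto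
    then show ?thesis using eb by simp
  qed
  have "b \<le> \<phi> x" if "x \<in> pverts G" for x
    using \<phi>M[OF that] unfolding b_def by linarith
  moreover have "continuous_on UNIV (\<lambda>t. c - h x * exp t)" for x
    by (intro continuous_intros)
  ultimately obtain v where "\<And>x. x \<in> pverts G \<Longrightarrow> \<Delta> v x = c - h x * exp (v x)"
    using sub_super_solution[of "pverts G" "\<lambda>x t. c - h x * exp t" "\<lambda>_. b" \<phi>] super sub
    by (auto simp: laplacian_const)
  then show ?thesis by (auto simp: kazdan_warner_solution_def)
qed

lemma kazdan_warner_solvable_mono:
  assumes "kazdan_warner_solution G w \<mu> h c\<^sub>0 u" "c\<^sub>0 \<le> c" "c < 0"
  shows "\<exists>u. kazdan_warner_solution G w \<mu> h c u"
  using assms by (intro kazdan_warner_solvable_from_upper[of c u])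
    (auto simp: kazdan_warner_solution_def)

section \<open>The Poisson equation on a connected graph\<close>

text \<open>Otherwise, by symmetry of the arcs, no path could leave \<open>S\<close>, and
  \<open>S\<close> would contain everything reachable from \<open>r\<close>.\<close>

lemma connected_crossing_arc:
  assumes "Digraph_Component.connected (with_proj G)" "S \<subseteq> pverts G" "r \<in> S" "S \<noteq> pverts G"
  obtains x y where "(x, y) \<in> parcs G" "x \<notin> S" "y \<in> S"
proof (rule ccontr)
  assume "\<not> thesis"
  then have no: "\<not> ((x, y) \<in> parcs G \<and> x \<notin> S \<and> y \<in> S)" for x y using that by blast
  obtain z where z: "z \<in> pverts G" "z \<notin> S" using assms by blast
  have "r \<in> pverts G" using assms by auto
  then have "r \<rightarrow>\<^sup>*\<^bsub>mk_symmetric (with_proj G)\<^esub> z"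
    using assms(1) z unfolding Digraph_Component.connected_def strongly_connected_def by simp
  then have "r \<rightarrow>\<^sup>*\<^bsub>with_proj G\<^esub> z"
    using reachable_mk_symmetric_eq[OF pair_sym_arcs] by simp
  then have "(r, z) \<in> (parcs G)\<^sup>*" using reachable_rtranclI by fastforce
  then have "z \<in> S"
    by (induct rule: rtrancl_induct) (use assms(3) no arcs_sym in blast)+
  with z show False by simp
qed

lemma laplacian_pos_of_neighbour:
  assumes "(x, y) \<in> parcs G" "u x = 0" "u y > 0" "\<And>z. u z \<ge> 0"
  shows "\<Delta> u x > 0"
proof -
  have "(\<Sum>y | (x, y) \<in> parcs G. w x y * (u y - u x)) > 0"
    using assms weight_pos finite_neighbours
    by (intro sum_pos2[of _ y]) (auto simp: less_imp_le)
  then show ?thesis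
    unfolding laplacian_def using measure_pos in_arcsD1[OF assms(1)] by simp
qed

text \<open>Built by enlarging the support of the barrier one vertex at a time: at a vertex outside the
  support but adjacent to it the Laplacian is already positive, so the value there can be raised
  from 0 a little.\<close>

lemma barrier:
  assumes "Digraph_Component.connected (with_proj G)" "r \<in> pverts G"
  obtains \<phi> where "\<And>x. x \<in> pverts G - {r} \<Longrightarrow> \<Delta> \<phi> x > 0"
proof -
  define P where "P S \<longleftrightarrow> S \<subseteq> pverts G \<and> r \<in> S \<and>
    (\<exists>\<phi>. (\<forall>x\<in>S. \<phi> x > 0) \<and> (\<forall>x. x \<notin> S \<longrightarrow> \<phi> x = 0) \<and> (\<forall>x\<in>S - {r}. \<Delta> \<phi> x > 0))" for S
  \<comment> \<open>The indicator of \<open>r\<close> works, since the Laplacian condition exempts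
    \<open>r\<close>. A set \<open>S\<close> of maximal cardinality then replaces an
    induction.\<close>
  have "P {r}"
    unfolding P_def using assms(2) by (auto intro!: exI[of _ "\<lambda>x. if x = r then 1 else 0"])
  moreover have "\<forall>S. P S \<longrightarrow> card S < Suc (card (pverts G))"
    unfolding P_def using pair_finite_verts by (auto simp: less_Suc_eq_le intro: card_mono)
  ultimately obtain S where S: "P S" and max: "\<And>T. P T \<Longrightarrow> card T \<le> card S"
    using ex_has_greatest_nat[of P "{r}" card] by blast
  obtain \<phi> where \<phi>: "\<And>x. x \<in> S \<Longrightarrow> \<phi> x > 0" "\<And>x. x \<notin> S \<Longrightarrow> \<phi> x = 0"
      "\<And>x. x \<in> S - {r} \<Longrightarrow> \<Delta> \<phi> x > 0" and SV: "S \<subseteq> pverts G" "r \<in> S"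
    using S unfolding P_def by blast
  have "S = pverts G"
  proof (rule ccontr)
    assume "S \<noteq> pverts G"
    then obtain x y where xy: "(x, y) \<in> parcs G" "x \<notin> S" "y \<in> S"
      using connected_crossing_arc[OF assms(1) SV] by blast
    have xV: "x \<in> pverts G" using xy in_arcsD1 by blast
    have "\<phi> z \<ge> 0" for z using \<phi>(1,2)[of z] by (cases "z \<in> S") auto
    then have "\<Delta> \<phi> x > 0"
      using laplacian_pos_of_neighbour[OF xy(1)] \<phi> xy by simp
    then obtain t where t: "0 < t" "0 < \<Delta> (\<phi>(x := t)) x"
      using raise_subsolution[of "\<lambda>_. 0" \<phi> x 1] \<phi>(2)[OF xy(2)] by auto
    have "\<Delta> (\<phi>(x := t)) z > 0" if "z \<in> insert x S - {r}" for z
    proof (cases "z = x")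
      case False
      then have z: "z \<in> S - {r}" using that by blast
      then have "\<Delta> \<phi> z \<le> \<Delta> (\<phi>(x := t)) z"
        using laplacian_raise[of z x \<phi> t] False SV t(1) \<phi>(2)[OF xy(2)] by auto
      then show ?thesis using \<phi>(3)[OF z] by simp
    qed (use t in simp)
    then have "P (insert x S)"
      unfolding P_def using SV xV \<phi>(1,2) t(1) by (auto intro!: exI[of _ "\<phi>(x := t)"])
    then have "card (insert x S) \<le> card S" by (rule max)
    then show False using xy(2) SV(1) pair_finite_verts finite_subset by fastforce
  qed
  then show thesis using \<phi>(3) by (intro that) auto
qed

lemma poisson_solvable:
  assumes "Digraph_Component.connected (with_proj G)" "(\<Sum>x\<in>pverts G. \<mu> x * f x) = 0"
  obtains v where "\<And>x. x \<in> pverts G \<Longrightarrow> \<Delta> v x = f x"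
proof -
  obtain r where r: "r \<in> pverts G" using verts_nonempty by blast
  obtain \<beta> where \<beta>: "\<And>x. x \<in> pverts G - {r} \<Longrightarrow> \<Delta> \<beta> x > 0"
    using barrier[OF assms(1) r] by blast
  \<comment> \<open>\<open>M\<close> dominates every ratio of \<open>\<bar>f x\<bar>\<close> to
    \<open>\<Delta> \<beta> x\<close>, making \<open>M * \<beta>\<close> a subsolution and its
    negative a supersolution away from \<open>r\<close>. The shifts by \<open>C\<close> put them in
    order without changing their Laplacians.\<close>
  define M where "M = (\<Sum>x\<in>pverts G - {r}. \<bar>f x\<bar> / \<Delta> \<beta> x)"
  define C where "C = (\<Sum>x\<in>pverts G. \<bar>M * \<beta> x\<bar>)"
  have fM: "\<bar>f x\<bar> \<le> M * \<Delta> \<beta> x" if x: "x \<in> pverts G - {r}" for x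
  proof -
    have "\<bar>f x\<bar> / \<Delta> \<beta> x \<le> M"
      unfolding M_def using x \<beta> pair_finite_verts
      by (intro member_le_sum) (auto intro!: divide_nonneg_pos)
    then show ?thesis using \<beta>[OF x] by (simp add: field_simps)
  qed
  have \<beta>C: "\<bar>M * \<beta> x\<bar> \<le> C" if "x \<in> pverts G" for x
    unfolding C_def using that pair_finite_verts by (intro member_le_sum) auto
  obtain v where v: "\<And>x. x \<in> pverts G - {r} \<Longrightarrow> \<Delta> v x = f x"
  proof (rule sub_super_solution[of "pverts G - {r}" "\<lambda>x _. f x" "\<lambda>x. M * \<beta> x + - C" "\<lambda>x. - M * \<beta> x + C"])
    fix x assume "x \<in> pverts G"
    from \<beta>C[OF this] show "M * \<beta> x + - C \<le> - M * \<beta> x + C" by simp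
  next
    fix x assume "x \<in> pverts G - {r}"
    note fx = fM[OF this]
    show "f x \<le> \<Delta> (\<lambda>x. M * \<beta> x + - C) x"
      unfolding laplacian_add_const laplacian_cmult using fx by linarith
    show "\<Delta> (\<lambda>x. - M * \<beta> x + C) x \<le> f x"
      unfolding laplacian_add_const laplacian_cmult using fx by linarith
  qed auto
  \<comment> \<open>Both sides have total mass 0 and agree off \<open>r\<close>, so they agree at
    \<open>r\<close>.\<close>
  have "\<Delta> v r = f r"
  proof -
    have "\<mu> r * \<Delta> v r + (\<Sum>x\<in>pverts G - {r}. \<mu> x * \<Delta> v x)
        = \<mu> r * f r + (\<Sum>x\<in>pverts G - {r}. \<mu> x * f x)"
      using sum_laplacian[of v] assms(2) r pair_finite_verts
      by (simp add: sum.remove)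
    then show ?thesis using v measure_pos[OF r] by simp
  qed
  with v show thesis by (intro that) blast
qed

section \<open>Solvability near 0 and the threshold\<close>

text \<open>If \<open>\<Delta> v = mean h - h\<close>, then \<open>a v + ln a\<close> is an upper solution for
  \<open>c = a * mean h / 2\<close> as soon as \<open>a\<close> is small enough that
  \<open>\<bar>h (exp (a v) - 1)\<bar> \<le> - mean h / 2\<close>.\<close>

lemma kazdan_warner_solvable_small:
  assumes "Digraph_Component.connected (with_proj G)" "mean G \<mu> h < 0"
  obtains c u where "c < 0" "kazdan_warner_solution G w \<mu> h c u"
proof -
  define m where "m = mean G \<mu> h"
  have m: "m < 0" using assms(2) by (simp add: m_def)
  have "(\<Sum>x\<in>pverts G. \<mu> x * (m - h x)) = m * vol G \<mu> - (\<Sum>x\<in>pverts G. \<mu> x * h x)"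
    by (simp add: vol_def right_diff_distrib sum_subtractf sum_distrib_left mult.commute)
  also have "\<dots> = 0" using vol_pos by (simp add: m_def mean_def)
  finally obtain v where v: "\<And>x. x \<in> pverts G \<Longrightarrow> \<Delta> v x = m - h x"
    using poisson_solvable[OF assms(1)] by metis
  \<comment> \<open>The left side tends to 0 as \<open>a\<close> decreases to 0, and there are only
    finitely many vertices to satisfy at once.\<close>
  have "eventually (\<lambda>a. \<forall>x\<in>pverts G. h x * (exp (a * v x) - 1) < - m / 2) (at_right 0)"
  proof (subst eventually_ball_finite_distrib[OF pair_finite_verts], rule ballI)
    fix x
    have "((\<lambda>a. h x * (exp (a * v x) - 1)) \<longlongrightarrow> h x * (exp (0 * v x) - 1)) (at_right 0)"
      by (intro tendsto_intros)
    then show "eventually (\<lambda>a. h x * (exp (a * v x) - 1) < - m / 2) (at_right 0)"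
      by (rule order_tendstoD) (use m in simp)
  qed
  then have "eventually (\<lambda>a. (\<forall>x\<in>pverts G. h x * (exp (a * v x) - 1) < - m / 2) \<and> 0 < a) (at_right (0::real))"
    by (intro eventually_conj eventually_at_right_less)
  then obtain a where small: "\<And>x. x \<in> pverts G \<Longrightarrow> h x * (exp (a * v x) - 1) < - m / 2" and a: "0 < a"
    using eventually_happens'[OF trivial_limit_at_right_real] by blast
  have c: "a * m / 2 < 0" using a m by (simp add: mult_pos_neg)
  have "\<Delta> (\<lambda>x. a * v x + ln a) x \<le> a * m / 2 - h x * exp (a * v x + ln a)" if x: "x \<in> pverts G" for x
  proof -
    have "a * (h x * (exp (a * v x) - 1)) \<le> a * (- m / 2)"
      using small[OF x] a by (intro mult_left_mono) auto
    then show ?thesis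
      unfolding laplacian_add_const laplacian_cmult v[OF x] using a
      by (simp add: exp_add algebra_simps)
  qed
  with c show thesis using kazdan_warner_solvable_from_upper that by meson
qed

text \<open>The threshold is the infimum of the admissible negative \<open>c\<close>, taken in
  \<open>ereal\<close> because that set may be unbounded below.\<close>

lemma kazdan_warner_threshold:
  assumes "Digraph_Component.connected (with_proj G)" "mean G \<mu> h < 0"
  obtains cm :: ereal where "cm < 0"
    and "\<And>c. cm < ereal c \<Longrightarrow> c < 0 \<Longrightarrow> \<exists>u. kazdan_warner_solution G w \<mu> h c u"
    and "\<And>c. ereal c < cm \<Longrightarrow> \<not> (\<exists>u. kazdan_warner_solution G w \<mu> h c u)"
proof -
  let ?S = "{c. c < 0 \<and> (\<exists>u. kazdan_warner_solution G w \<mu> h c u)}"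
  define cm where "cm = Inf (ereal ` ?S)"
  obtain c\<^sub>0 where c\<^sub>0: "c\<^sub>0 \<in> ?S" using kazdan_warner_solvable_small[OF assms] by blast
  have "cm \<le> ereal c\<^sub>0" unfolding cm_def using c\<^sub>0 by (intro Inf_lower) blast
  also have "ereal c\<^sub>0 < 0" using c\<^sub>0 by simp
  finally have neg: "cm < 0" .
  show thesis
  proof (rule that[OF neg])
    fix c :: real assume "cm < ereal c" "c < 0"
    then obtain d where "d \<in> ?S" "d < c" unfolding cm_def Inf_less_iff by auto
    then show "\<exists>u. kazdan_warner_solution G w \<mu> h c u"
      using kazdan_warner_solvable_mono \<open>c < 0\<close> by (auto dest: less_imp_le)
  next
    fix c :: real assume c: "ereal c < cm"
    \<comment> \<open>Negativity of \<open>c\<close> is what turns \<open>c \<notin> ?S\<close> into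
      the absence of a solution.\<close>
    then have "ereal c < 0" using neg by (rule less_trans)
    then have "c < 0" by simp
    moreover have "c \<notin> ?S"
    proof
      assume "c \<in> ?S"
      then have "cm \<le> ereal c" unfolding cm_def by (intro Inf_lower) blast
      then show False using c by simp
    qed
    ultimately show "\<not> (\<exists>u. kazdan_warner_solution G w \<mu> h c u)" by simp
  qed
qed

end

text \<open>Connectedness matters in (ii): if \<open>h\<close> is positive on one component and very
  negative on another, its mean can be negative, yet (i) applied to the first component excludes
  every solution with \<open>c < 0\<close>.\<close>

theorem theorem3:
  fixes G :: "'a pair_pre_digraph"
    and w :: "'a \<Rightarrow> 'a \<Rightarrow> real"
    and \<mu> h :: "'a \<Rightarrow> real"
  assumes "weighted_graph G w \<mu>"
  shows "(\<forall>c::real. c < 0 \<longrightarrow> (\<exists>u. kazdan_warner_solution G w \<mu> h c u) \<longrightarrow> mean G \<mu> h < 0)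
    \<and> (Digraph_Component.connected (with_proj G) \<longrightarrow> mean G \<mu> h < 0 \<longrightarrow>
        (\<exists>cm::ereal. - \<infinity> \<le> cm \<and> cm < 0 \<and>
           (\<forall>c::real. cm < ereal c \<and> c < 0 \<longrightarrow> (\<exists>u. kazdan_warner_solution G w \<mu> h c u)) \<and>
           (\<forall>c::real. ereal c < cm \<longrightarrow> \<not> (\<exists>u. kazdan_warner_solution G w \<mu> h c u))))"
proof -
  interpret weighted_graph G w \<mu> by fact
  show ?thesis
  proof (intro conjI allI impI)
    show "mean G \<mu> h < 0" if "c < 0" "\<exists>u. kazdan_warner_solution G w \<mu> h c u" for c
      using solution_imp_mean_neg that by blast
  next
    assume "Digraph_Component.connected (with_proj G)" "mean G \<mu> h < 0"
    then obtain cm :: ereal where "cm < 0"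
      "\<And>c. cm < ereal c \<Longrightarrow> c < 0 \<Longrightarrow> \<exists>u. kazdan_warner_solution G w \<mu> h c u"
      "\<And>c. ereal c < cm \<Longrightarrow> \<not> (\<exists>u. kazdan_warner_solution G w \<mu> h c u)"
      using kazdan_warner_threshold by blast
    then show "\<exists>cm::ereal. - \<infinity> \<le> cm \<and> cm < 0 \<and>
        (\<forall>c::real. cm < ereal c \<and> c < 0 \<longrightarrow> (\<exists>u. kazdan_warner_solution G w \<mu> h c u)) \<and>
        (\<forall>c::real. ereal c < cm \<longrightarrow> \<not> (\<exists>u. kazdan_warner_solution G w \<mu> h c u))"
      by (intro exI[of _ cm]) auto
  qed
qed

end
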